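(* Let $(k,k')\in\mathcal{K}_\omega\times\mathcal{K}_\omega$ be two conjugate kernels on $[0,1]$ and let $f:[0,1]\times\mathbb{R}\to\mathbb{R}$ be a continuous function. Assume that: (A1) $I_0^k y\in C([0,1];\mathbb{R})$ for all $y\in C([0,1];\mathbb{R})$; (A2) for all $(t,x_1,x_2)\in[0,1]\times\mathbb{R}\times\mathbb{R}$, $|f(t,x_1)-f(t,x_2)|\leq c_f|x_1-x_2|$, where $c_f$ is a positive constant such that $c_f\|I_0^k 1\|_\infty<1$. Then the boundary value problem $$(D_0^{k'}u)(t)=f(t,u(t)),\ \text{ a.e. } t\in[0,1],\qquad (I_0^{k'}u)(0)=0,$$ where the unknown $u\in C([0,1];\mathbb{R})$ is required to be such that $I_0^{k'}u$ admits an absolutely continuous representative, admits one and only one solution $u^*\in C([0,1];\mathbb{R})$.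
   Context: Let $\mathbb{R}_+=(0,+\infty)$ and $\Omega=\{(x,y)\in[0,1]\times[0,1] : x>y\}$. Fix a weight function $\omega:[0,1]\to\mathbb{R}_+$ such that $\omega,1/\omega\in L^\infty([0,1];\mathbb{R})$. Let $\mathcal{K}_\omega$ be the set of measurable $k:\Omega\to\mathbb{R}_+$ such that $F_k(y)=\int_y^1 k(x,y)\omega(x)\,dx$ belongs to $L^\infty([0,1);\mathbb{R})$ and $G_k(y)=\int_0^y k(y,x)\omega(x)\,dx$ belongs to $L^\infty((0,1];\mathbb{R})$. For $k_1,k_2\in\mathcal{K}_\omega$ put $\delta_{k_1,k_2}(x,y)=\int_y^x k_1(x,z)k_2(z,y)\omega(z)\,dz$ for $(x,y)\in\Omega$. Kernels $k,k'\in\mathcal{K}_\omega$ are conjugate if $\delta_{k,k'}(x,y)=\delta_{k',k}(x,y)=1$ for all $(x,y)\in\Omega$. For $k\in\mathcal{K}_\omega$ and $f\in L^1([0,1];\mathbb{R})$ the left-sided $k$-integral is $(I_0^kf)(x)=\int_0^x k(x,y)f(y)\omega(y)\,dy$ for a.e. $x\in[0,1]$; functions are identified when equal a.e., and when $I_0^kf$ agrees a.e. with a continuous (resp. absolutely continuous) function on $[0,1]$ it is identified with that representative. In particular $(I_0^{k'}u)(0)$ denotes the value at $0$ of the absolutely continuous representative of $I_0^{k'}u$. If $u\in L^1([0,1];\mathbb{R})$ and $I_0^{k'}u$ has an absolutely continuous representative, $(D_0^{k'}u)(x)=\frac{1}{\omega(x)}\frac{d}{dx}(I_0^{k'}u)(x)$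 for a.e. $x\in[0,1]$. $C([0,1];\mathbb{R})$ is equipped with the norm $\|y\|_\infty=\max\{|y(t)|:0\le t\le1\}$, and $I_0^k1$ is the $k$-integral of the constant function $1$. *)

theory Defs
  imports "HOL-Analysis.Analysis"
begin

definition Linfty_on :: "real set \<Rightarrow> (real \<Rightarrow> real) \<Rightarrow> bool" where
  "Linfty_on S g \<longleftrightarrow> g \<in> borel_measurable (lebesgue_on S) \<and>
     (\<exists>C. AE x in lebesgue_on S. \<bar>g x\<bar> \<le> C)"

definition weight_function :: "(real \<Rightarrow> real) \<Rightarrow> bool" where
  "weight_function w \<longleftrightarrow> (\<forall>x\<in>{0..1}. w x > 0) \<and>
     Linfty_on {0..1} w \<and> Linfty_on {0..1} (\<lambda>x. 1 / w x)"

text \<open>Kernels are total functions here, but only their values on the triangle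
  \<open>Omega\<close> are ever used: all integrals below run over open or half-open intervals
  on which the arguments of the kernels stay in \<open>Omega\<close>.\<close>

definition Omega :: "(real \<times> real) set" where
  "Omega = {(x, y). x \<in> {0..1} \<and> y \<in> {0..1} \<and> x > y}"

definition F_int :: "(real \<Rightarrow> real) \<Rightarrow> (real \<Rightarrow> real \<Rightarrow> real) \<Rightarrow> real \<Rightarrow> real" where
  "F_int w k y = (LINT x:{y<..1}|lebesgue. k x y * w x)"

definition G_int :: "(real \<Rightarrow> real) \<Rightarrow> (real \<Rightarrow> real \<Rightarrow> real) \<Rightarrow> real \<Rightarrow> real" where
  "G_int w k y = (LINT x:{0..<y}|lebesgue. k y x * w x)"

text \<open>The Bochner integral of a non-integrable function is 0. For the nonnegative
  integrands of \<open>F_int\<close> and \<open>G_int\<close>, membership in \<open>L\<^sup>\<infinity>\<close> entails that the integrals are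
  finite almost everywhere, so this is required explicitly.\<close>

definition kernel_class :: "(real \<Rightarrow> real) \<Rightarrow> (real \<Rightarrow> real \<Rightarrow> real) set" where
  "kernel_class w = {k.
     (\<lambda>(x, y). k x y) \<in> borel_measurable (lebesgue_on Omega) \<and>
     (\<forall>(x, y)\<in>Omega. k x y > 0) \<and>
     (AE y in lebesgue_on {0..<1}. set_integrable lebesgue {y<..1} (\<lambda>x. k x y * w x)) \<and>
     Linfty_on {0..<1} (F_int w k) \<and>
     (AE y in lebesgue_on {0<..1}. set_integrable lebesgue {0..<y} (\<lambda>x. k y x * w x)) \<and>
     Linfty_on {0<..1} (G_int w k)}"

definition kernel_delta ::
  "(real \<Rightarrow> real) \<Rightarrow> (real \<Rightarrow> real \<Rightarrow> real) \<Rightarrow> (real \<Rightarrow> real \<Rightarrow> real) \<Rightarrow> real \<Rightarrow> real \<Rightarrow> real" where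
  "kernel_delta w k1 k2 x y = (LINT z:{y<..<x}|lebesgue. k1 x z * k2 z y * w z)"

definition conjugate_kernels ::
  "(real \<Rightarrow> real) \<Rightarrow> (real \<Rightarrow> real \<Rightarrow> real) \<Rightarrow> (real \<Rightarrow> real \<Rightarrow> real) \<Rightarrow> bool" where
  "conjugate_kernels w k k' \<longleftrightarrow>
     (\<forall>(x, y)\<in>Omega. kernel_delta w k k' x y = 1 \<and> kernel_delta w k' k x y = 1)"

definition left_integral ::
  "(real \<Rightarrow> real) \<Rightarrow> (real \<Rightarrow> real \<Rightarrow> real) \<Rightarrow> (real \<Rightarrow> real) \<Rightarrow> real \<Rightarrow> real" where
  "left_integral w k f x = (LINT y:{0..<x}|lebesgue. k x y * f y * w y)"

definition abs_cont_on_unit :: "(real \<Rightarrow> real) \<Rightarrow> bool" where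
  "abs_cont_on_unit g \<longleftrightarrow>
     (\<forall>e>0. \<exists>d>0. \<forall>(n::nat) a b.
        (\<forall>i<n. 0 \<le> a i \<and> a i \<le> b i \<and> b i \<le> 1) \<longrightarrow>
        disjoint_family_on (\<lambda>i. {a i<..<b i}) {..<n} \<longrightarrow>
        (\<Sum>i<n. b i - a i) < d \<longrightarrow>
        (\<Sum>i<n. \<bar>g (b i) - g (a i)\<bar>) < e)"

definition is_cont_rep :: "(real \<Rightarrow> real) \<Rightarrow> (real \<Rightarrow> real) \<Rightarrow> bool" where
  "is_cont_rep h g \<longleftrightarrow> continuous_on {0..1} g \<and> (AE x in lebesgue_on {0..1}. h x = g x)"

definition is_ac_rep :: "(real \<Rightarrow> real) \<Rightarrow> (real \<Rightarrow> real) \<Rightarrow> bool" where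
  "is_ac_rep h g \<longleftrightarrow> abs_cont_on_unit g \<and> (AE x in lebesgue_on {0..1}. h x = g x)"

text \<open>A continuous or absolutely continuous representative is unique as a function on
  \<open>[0,1]\<close>; the choice only affects the irrelevant values outside this interval.\<close>

definition cont_rep :: "(real \<Rightarrow> real) \<Rightarrow> real \<Rightarrow> real" where
  "cont_rep h = (SOME g. is_cont_rep h g)"

definition ac_rep :: "(real \<Rightarrow> real) \<Rightarrow> real \<Rightarrow> real" where
  "ac_rep h = (SOME g. is_ac_rep h g)"

definition sup_norm :: "(real \<Rightarrow> real) \<Rightarrow> real" where
  "sup_norm g = (SUP t\<in>{0..1}. \<bar>g t\<bar>)"

definition left_derivative ::
  "(real \<Rightarrow> real) \<Rightarrow> (real \<Rightarrow> real \<Rightarrow> real) \<Rightarrow> (real \<Rightarrow> real) \<Rightarrow> real \<Rightarrow> real" where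
  "left_derivative w k u x = 1 / w x * deriv (ac_rep (left_integral w k u)) x"

text \<open>Since \<open>deriv\<close> is a total operator with an arbitrary value at points of
  non-differentiability, the differential equation is read as asserting, at almost every
  point, that the derivative exists (which is automatic for absolutely continuous
  functions) and satisfies the equation.\<close>

definition bvp_solution ::
  "(real \<Rightarrow> real) \<Rightarrow> (real \<Rightarrow> real \<Rightarrow> real) \<Rightarrow> (real \<Rightarrow> real \<Rightarrow> real) \<Rightarrow> (real \<Rightarrow> real) \<Rightarrow> bool" where
  "bvp_solution w k' f u \<longleftrightarrow>
     continuous_on {0..1} u \<and>
     (\<exists>g. is_ac_rep (left_integral w k' u) g) \<and>
     (AE t in lebesgue_on {0..1}.
        ac_rep (left_integral w k' u) differentiable (at t) \<and>
        left_derivative w k' u t = f t (u t)) \<and>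
     ac_rep (left_integral w k' u) 0 = 0"

end

theory Submission
  imports Defs
begin

text \<open>
  Conjugacy and Fubini give \<open>I\<^sup>k I\<^bsup>k'\<^esup> = I\<^bsup>k'\<^esup> I\<^sup>k = J\<close>, where \<open>J \<phi> (x)\<close> is the integral of
  \<open>\<phi> \<omega>\<close> over \<open>[0,x]\<close>. By the fundamental theorem of calculus for absolutely continuous
  functions, the boundary value problem says \<open>I\<^bsup>k'\<^esup> u = J (f(\<cdot>,u)) = I\<^bsup>k'\<^esup> (I\<^sup>k f(\<cdot>,u))\<close>. Applying
  \<open>I\<^sup>k\<close> turns this into \<open>J (u - I\<^sup>k f(\<cdot>,u)) = 0\<close>, so it is equivalent to the fixed point equation
  \<open>u = I\<^sup>k f(\<cdot>,u)\<close>, whose right-hand side is a contraction with constant \<open>c \<parallel>I\<^sup>k 1\<parallel>\<close>.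
\<close>

section \<open>Composition of conjugate kernel integrals\<close>

text \<open>The kernels are measurable only for the completed measure on the plane, so single
  sections may behave badly. Fubini is therefore applied in the product of two copies of
  \<open>lborel\<close>, to Borel functions that agree almost everywhere with the given data. The
  interchange is legitimate because the outer kernel times the weight is integrable in its second
  argument for almost every first argument, while the \<open>G_int\<close> of the inner kernel is
  essentially bounded.

  The other obstacle is that integral identities hold only almost everywhere, whereas
  \<open>cont_rep\<close> and \<open>ac_rep\<close> are choices that are arbitrary outside [0,1].
  Each identity is therefore moved to continuous functions, for which equality almost everywhere is
  equality on [0,1]. This is the role of (A1): it makes the difference of u and the k-integral of
  f(.,u) continuous up to a null set, and it turns the pointwise contraction estimate into one for
  the supremum norm. Finally J can be cancelled because the derivative of J applied to a continuous
  function is, almost everywhere, that function times a positive weight.\<close>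

lemma AE_lebesgue_on_iff:
  assumes "S \<in> sets lebesgue"
  shows "(AE x in lebesgue_on S. P x) \<longleftrightarrow> (AE x in lborel. x \<in> S \<longrightarrow> P x)"
  using assms by (simp add: AE_restrict_space_iff AE_completion_iff)

text \<open>No measurability is needed: by completeness of the measure both integrands are measurable or
  neither is, and in the latter case both integrals are 0.\<close>

lemma integral_cong_AE_lebesgue:
  fixes f g :: "real \<Rightarrow> real"
  assumes "AE x in lborel. f x = g x"
  shows "integral\<^sup>L lebesgue f = integral\<^sup>L lebesgue g"
proof -
  have AE: "AE x in lebesgue. f x = g x" "AE x in lebesgue. g x = f x"
    using assms by (simp_all add: AE_completion_iff eq_commute)
  show ?thesis
  proof (cases "f \<in> borel_measurable lebesgue")
    case True
    thus ?thesis using AE borel_measurable_AE by (intro integral_cong_AE) blast+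
  next
    case False
    hence "g \<notin> borel_measurable lebesgue" using AE borel_measurable_AE by blast
    with False have "\<not> integrable lebesgue f" "\<not> integrable lebesgue g"
      using borel_measurable_integrable by blast+
    thus ?thesis by (simp add: not_integrable_integral_eq)
  qed
qed

lemma Omega_borel: "Omega \<in> sets borel"
proof -
  have "Omega = {0..1} \<times> {0..1} \<inter> {p. snd p < fst p}" by (auto simp: Omega_def)
  moreover have "open {p :: real \<times> real. snd p < fst p}"
    by (intro open_Collect_less continuous_intros)
  moreover have "closed ({0..1} \<times> {0..1} :: (real \<times> real) set)"
    by (intro closed_Times) auto
  ultimately show ?thesis by (metis borel_closed borel_open sets.Int)
qed

text \<open>Extended by zero, the kernel is Lebesgue measurable on the plane and hence equal almost
  everywhere to a Borel function; slicing the exceptional null set gives null sections. Both slicing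
  orders are recorded because the two iterated integrals in Fubini's theorem each need one of
  them.\<close>

lemma kernel_borel_version:
  assumes "k \<in> kernel_class w"
  obtains K where "K \<in> borel_measurable borel"
    "AE x in lborel. AE y in lborel. (x, y) \<in> Omega \<longrightarrow> k x y = K (x, y)"
    "AE y in lborel. AE x in lborel. (x, y) \<in> Omega \<longrightarrow> k x y = K (x, y)"
proof -
  have "(\<lambda>p. if p \<in> Omega then (case p of (x, y) \<Rightarrow> k x y) else 0) \<in> borel_measurable lebesgue"
    using assms Omega_borel by (subst borel_measurable_if) (auto simp: kernel_class_def)
  from completion_ex_borel_measurable_real[OF this]
  obtain K where K: "K \<in> borel_measurable lborel"
    and AE: "AE p in lborel. (if p \<in> Omega then (case p of (x, y) \<Rightarrow> k x y) else 0) = K p"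
    by auto
  from AE have AE2: "AE p in lborel \<Otimes>\<^sub>M lborel. p \<in> Omega \<longrightarrow> (case p of (x, y) \<Rightarrow> k x y) = K p"
    unfolding lborel_prod by eventually_elim auto
  have AE3: "AE x in lborel. AE y in lborel. (x, y) \<in> Omega \<longrightarrow> k x y = K (x, y)"
    using lborel_pair.AE_pair[OF AE2] by simp
  \<comment> \<open>\<open>AE_pair\<close> slices in one order only; the other order comes from the
    invariance of the product measure under swapping the coordinates.\<close>
  have "AE p in distr (lborel \<Otimes>\<^sub>M lborel) (lborel \<Otimes>\<^sub>M lborel) (\<lambda>(x, y). (y, x)).
          p \<in> Omega \<longrightarrow> (case p of (x, y) \<Rightarrow> k x y) = K p"
    using AE2 lborel_pair.distr_pair_swap by metis
  hence "AE p in lborel \<Otimes>\<^sub>M lborel. (case p of (y, x) \<Rightarrow> (x, y) \<in> Omega \<longrightarrow> k x y = K (x, y))"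
    by (auto dest!: AE_distrD[rotated] simp: case_prod_beta' elim: eventually_mono)
  hence "AE y in lborel. AE x in lborel. (x, y) \<in> Omega \<longrightarrow> k x y = K (x, y)"
    using lborel_pair.AE_pair by fastforce
  with K AE3 show ?thesis by (intro that) auto
qed

text \<open>After interchanging the integrals, the inner one is
  \<open>kernel_delta w k1 k2 x y\<close>, which conjugacy makes equal to 1, so only the integral of
  \<open>\<phi> y * w y\<close> remains.\<close>

lemma left_integral_compose:
  fixes w \<phi> :: "real \<Rightarrow> real"
  assumes weight: "weight_function w"
    and k1: "k1 \<in> kernel_class w" and k2: "k2 \<in> kernel_class w"
    and delta: "\<And>x y. (x, y) \<in> Omega \<Longrightarrow> kernel_delta w k1 k2 x y = 1"
    and \<phi>_meas: "\<phi> \<in> borel_measurable (lebesgue_on {0..1})"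
    and \<phi>_bdd: "\<And>x. x \<in> {0..1} \<Longrightarrow> \<bar>\<phi> x\<bar> \<le> B"
  shows "AE x in lebesgue_on {0..1}.
           left_integral w k1 (left_integral w k2 \<phi>) x = (LINT y:{0..<x}|lebesgue. \<phi> y * w y)"
proof -
  obtain K where K[measurable]: "K \<in> borel_measurable borel"
    and K1: "AE x in lborel. AE y in lborel. (x, y) \<in> Omega \<longrightarrow> k2 x y = K (x, y)"
    and K2: "AE y in lborel. AE x in lborel. (x, y) \<in> Omega \<longrightarrow> k2 x y = K (x, y)"
    using kernel_borel_version[OF k2] by blast
  define q where "q = (\<lambda>y. indicator {0..1} y * (\<phi> y * w y))"
  have w_meas: "w \<in> borel_measurable (lebesgue_on {0..1})"
    using weight by (auto simp: weight_function_def Linfty_on_def)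
  have "(\<lambda>y. if y \<in> {0..1} then \<phi> y * w y else 0) \<in> borel_measurable lebesgue"
    using w_meas \<phi>_meas by (subst borel_measurable_if) auto
  also have "(\<lambda>y. if y \<in> {0..1} then \<phi> y * w y else 0) = q"
    by (auto simp: q_def fun_eq_iff)
  finally have q_meas: "q \<in> borel_measurable lebesgue" .
  then obtain Q where Q[measurable]: "Q \<in> borel_measurable borel" and qQ: "AE y in lborel. q y = Q y"
    using completion_ex_borel_measurable_real[of q lborel] by auto
  have w_pos: "w x > 0" if "x \<in> {0..1}" for x
    using weight that by (auto simp: weight_function_def)
  have k_pos: "k2 x y > 0" if "(x, y) \<in> Omega" for x y
    using k2 that by (auto simp: kernel_class_def)
  have B: "B \<ge> 0" using \<phi>_bdd[of 0] by auto
  from k2 obtain C where C: "AE z in lebesgue_on {0<..1}. \<bar>G_int w k2 z\<bar> \<le> C"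
    by (auto simp: kernel_class_def Linfty_on_def)
  have C: "AE z in lborel. z \<in> {0<..1} \<longrightarrow> \<bar>G_int w k2 z\<bar> \<le> C"
    using C by (subst (asm) AE_lebesgue_on_iff) auto
  have int2: "AE z in lborel. z \<in> {0<..1} \<longrightarrow> set_integrable lebesgue {0..<z} (\<lambda>y. k2 z y * w y)"
    using k2 by (subst AE_lebesgue_on_iff[symmetric]) (auto simp: kernel_class_def)
  have int1: "AE x in lborel. x \<in> {0<..1} \<longrightarrow> set_integrable lebesgue {0..<x} (\<lambda>z. k1 x z * w z)"
    using k1 by (subst AE_lebesgue_on_iff[symmetric]) (auto simp: kernel_class_def)
  have main: "left_integral w k1 (left_integral w k2 \<phi>) x = (LINT y:{0..<x}|lebesgue. \<phi> y * w y)"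
    if x: "x \<in> {0<..1}" and intx: "set_integrable lebesgue {0..<x} (\<lambda>z. k1 x z * w z)" for x
  proof -
    define p where "p = (\<lambda>z. indicator {0..<x} z * (k1 x z * w z))"
    have p_int: "integrable lebesgue p"
      using intx by (simp add: p_def set_integrable_def)
    then obtain P where P[measurable]: "P \<in> borel_measurable borel" and pP: "AE z in lborel. p z = P z"
      using completion_ex_borel_measurable_real[of p lborel] by auto
    have P_int: "integrable lborel P"
    proof -
      have "integrable lebesgue P"
        using integrable_cong_AE_imp[OF p_int, of P] pP
        by (auto simp: AE_completion_iff measurable_completion eq_commute)
      thus ?thesis by (subst (asm) integrable_completion) auto
    qed
    \<comment> \<open>The Borel integrand on the plane for fixed \<open>x\<close>: \<open>P\<close>
      stands for \<open>k1 x z * w z\<close> on [0,x), \<open>K\<close> for \<open>k2\<close>, and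
      \<open>Q\<close> for \<open>\<phi> y * w y\<close>.\<close>
    define H where "H = (\<lambda>z y. P z * (if 0 \<le> y \<and> y < z then K (z, y) * Q y else 0))"
    have Km[measurable]: "(\<lambda>p. K (fst p, snd p)) \<in> borel_measurable (lborel \<Otimes>\<^sub>M lborel)"
      unfolding lborel_prod by simp
    have H[measurable]: "(\<lambda>(z, y). H z y) \<in> borel_measurable (lborel \<Otimes>\<^sub>M lborel)"
      unfolding H_def case_prod_beta' by measurable
    have Hz[measurable]: "(\<lambda>y. H z y) \<in> borel_measurable lborel" for z
      using measurable_Pair2[OF H, of z] by simp
    have Hy[measurable]: "(\<lambda>z. H z y) \<in> borel_measurable lborel" for y
      using measurable_Pair1[OF H, of y] by simp
    \<comment> \<open>The point 0 lies in the support of \<open>p\<close>, but the assumptions on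
      \<open>G_int\<close> and on the sections of \<open>k2\<close> only cover (0,1].\<close>
    have z0: "AE z in lborel. z \<noteq> (0::real)"
      by (rule AE_lborel_singleton)
    \<comment> \<open>Besides the value of the inner integral, this dominates the absolute inner
      integral by a multiple of the integrable \<open>P\<close>, as Tonelli's criterion for
      \<open>H\<close> requires. The factor combines the bound of \<open>\<phi>\<close> with the
      essential bound of \<open>G_int w k2\<close>.\<close>
    have sec1: "AE z in lborel. integrable lborel (H z) \<and>
         integral\<^sup>L lborel (H z) = p z * left_integral w k2 \<phi> z \<and>
         (\<integral>y. norm (H z y) \<partial>lborel) \<le> norm (B * C * P z)"
      using K1 pP C int2 z0
    proof eventually_elim
      case (elim z)
      show ?case
      proof (cases "z \<in> {0<..<x}")
        case False
        hence "p z = 0" using elim by (auto simp: p_def)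
        moreover from this have "H z = (\<lambda>_. 0)" using elim by (auto simp: H_def)
        ultimately show ?thesis by simp
      next
        case True
        have zz: "z \<in> {0<..1}" using True x by auto
        define g where "g = (\<lambda>y. indicator {0..<z} y * (k2 z y * w y))"
        have g_int: "integrable lebesgue g"
          using elim zz by (simp add: g_def set_integrable_def)
        have eq: "AE y in lborel. H z y = P z * (indicator {0..<z} y * (k2 z y * \<phi> y * w y))"
          using elim(1) qQ
        proof eventually_elim
          case (elim y)
          show ?case using elim zz by (auto simp: H_def q_def Omega_def indicator_def split: if_splits)
        qed
        have bound: "AE y in lborel. norm (H z y) \<le> norm (P z) * B * g y"
          using eq
        proof eventually_elim
          case (elim y)
          show ?case
          proof (cases "y \<in> {0..<z}")
            case True
            have y1: "y \<in> {0..1}" "(z, y) \<in> Omega" using True zz by (auto simp: Omega_def)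
            have "norm (H z y) = norm (P z) * (k2 z y * w y) * \<bar>\<phi> y\<bar>"
              using elim True w_pos[OF y1(1)] k_pos[OF y1(2)] by (simp add: abs_mult)
            also have "\<dots> \<le> norm (P z) * (k2 z y * w y) * B"
              using w_pos[OF y1(1)] k_pos[OF y1(2)] \<phi>_bdd[OF y1(1)] by (intro mult_left_mono) auto
            finally show ?thesis using True by (simp add: g_def mult_ac)
          qed (use elim in \<open>auto simp: g_def\<close>)
        qed
        have Hl: "H z \<in> borel_measurable lebesgue" using Hz by (rule measurable_completion)
        have Hi: "integrable lebesgue (H z)"
        proof (rule Bochner_Integration.integrable_bound)
          show "integrable lebesgue (\<lambda>y. norm (P z) * B * g y)" using g_int by simp
          show "AE y in lebesgue. norm (H z y) \<le> norm (norm (P z) * B * g y)"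
            unfolding AE_completion_iff using bound by eventually_elim simp
        qed (rule Hl)
        have 1: "integrable lborel (H z)" using Hi by (subst (asm) integrable_completion) auto
        have "integral\<^sup>L lborel (H z) = integral\<^sup>L lebesgue (H z)"
          by (rule integral_completion[symmetric]) simp
        also have "\<dots> = (\<integral>y. P z * (indicator {0..<z} y * (k2 z y * \<phi> y * w y)) \<partial>lebesgue)"
          by (rule integral_cong_AE_lebesgue[OF eq])
        also have "\<dots> = p z * left_integral w k2 \<phi> z"
          using elim by (simp add: left_integral_def set_lebesgue_integral_def)
        finally have 2: "integral\<^sup>L lborel (H z) = p z * left_integral w k2 \<phi> z" .
        have "(\<integral>y. norm (H z y) \<partial>lborel) = (\<integral>y. norm (H z y) \<partial>lebesgue)"
          by (rule integral_completion[symmetric]) simp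
        also have "\<dots> \<le> (\<integral>y. norm (P z) * B * g y \<partial>lebesgue)"
          using Hi g_int bound by (intro integral_mono_AE) (auto simp: AE_completion_iff)
        also have "\<dots> = norm (P z) * B * G_int w k2 z"
          by (simp add: g_def G_int_def set_lebesgue_integral_def)
        also have "\<dots> \<le> norm (P z) * B * \<bar>C\<bar>"
          using elim zz B by (intro mult_left_mono) auto
        also have "\<dots> = norm (B * C * P z)" using B by (simp add: abs_mult)
        finally show ?thesis using 1 2 by blast
      qed
    qed
    have H_int: "integrable (lborel \<Otimes>\<^sub>M lborel) (\<lambda>(z, y). H z y)"
    proof (rule lborel_pair.Fubini_integrable[OF H])
      show "integrable lborel (\<lambda>z. \<integral>y. norm (case (z, y) of (z, y) \<Rightarrow> H z y) \<partial>lborel)"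
      proof (rule Bochner_Integration.integrable_bound[of _ "\<lambda>z. B * C * P z"])
        show "AE z in lborel. norm (\<integral>y. norm (case (z, y) of (z, y) \<Rightarrow> H z y) \<partial>lborel) \<le> norm (B * C * P z)"
          using sec1 by eventually_elim auto
        show "(\<lambda>z. \<integral>y. norm (case (z, y) of (z, y) \<Rightarrow> H z y) \<partial>lborel) \<in> borel_measurable lborel"
          by measurable
      qed (use P_int in auto)
      show "AE z in lborel. integrable lborel (\<lambda>y. case (z, y) of (z, y) \<Rightarrow> H z y)"
        using sec1 by eventually_elim auto
    qed
    \<comment> \<open>The opposite order: for fixed \<open>y\<close> the integrand is supported in
      \<open>y < z < x\<close>, and what is integrated there is exactly the integrand of
      \<open>kernel_delta\<close>.\<close>
    have sec2: "AE y in lborel. (\<integral>z. H z y \<partial>lborel) = indicator {0..<x} y * (\<phi> y * w y)"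
      using K2 qQ
    proof eventually_elim
      case (elim y)
      have "(\<integral>z. H z y \<partial>lborel) = (\<integral>z. H z y \<partial>lebesgue)"
        by (rule integral_completion[symmetric]) simp
      also have "\<dots> = (\<integral>z. indicator {0..<x} y * q y * (indicator {y<..<x} z * (k1 x z * k2 z y * w z)) \<partial>lebesgue)"
      proof (rule integral_cong_AE_lebesgue)
        show "AE z in lborel. H z y =
           indicator {0..<x} y * q y * (indicator {y<..<x} z * (k1 x z * k2 z y * w z))"
          using elim(1) pP
        proof eventually_elim
          case (elim z)
          thus ?case using \<open>q y = Q y\<close> x
            by (auto simp: H_def p_def q_def Omega_def indicator_def split: if_splits)
        qed
      qed
      also have "\<dots> = indicator {0..<x} y * q y * kernel_delta w k1 k2 x y"
        by (simp add: kernel_delta_def set_lebesgue_integral_def)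
      also have "\<dots> = indicator {0..<x} y * (\<phi> y * w y)"
        using delta[of x y] x by (auto simp: q_def Omega_def indicator_def)
      finally show ?case .
    qed
    have "left_integral w k1 (left_integral w k2 \<phi>) x = (\<integral>z. p z * left_integral w k2 \<phi> z \<partial>lebesgue)"
      by (simp add: left_integral_def set_lebesgue_integral_def p_def mult_ac)
    also have "\<dots> = (\<integral>z. integral\<^sup>L lborel (H z) \<partial>lebesgue)"
    proof (intro integral_cong_AE_lebesgue)
      show "AE z in lborel. p z * left_integral w k2 \<phi> z = integral\<^sup>L lborel (H z)"
        using sec1 by eventually_elim simp
    qed
    also have "\<dots> = (\<integral>z. integral\<^sup>L lborel (H z) \<partial>lborel)"
      by (rule integral_completion) measurable
    also have "\<dots> = (\<integral>y. (\<integral>z. H z y \<partial>lborel) \<partial>lborel)"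
      by (rule lborel_pair.Fubini_integral[OF H_int, symmetric])
    also have "\<dots> = (\<integral>y. (\<integral>z. H z y \<partial>lborel) \<partial>lebesgue)"
      by (rule integral_completion[symmetric]) measurable
    also have "\<dots> = (\<integral>y. indicator {0..<x} y * (\<phi> y * w y) \<partial>lebesgue)"
      by (rule integral_cong_AE_lebesgue[OF sec2])
    also have "\<dots> = (LINT y:{0..<x}|lebesgue. \<phi> y * w y)"
      by (simp add: set_lebesgue_integral_def)
    finally show ?thesis .
  qed
  have "AE x in lborel. x \<noteq> (0::real)" by (rule AE_lborel_singleton)
  hence "AE x in lborel. x \<in> {0..1} \<longrightarrow>
     left_integral w k1 (left_integral w k2 \<phi>) x = (LINT y:{0..<x}|lebesgue. \<phi> y * w y)"
    using int1 by eventually_elim (auto intro!: main)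
  thus ?thesis by (subst AE_lebesgue_on_iff) auto
qed

section \<open>Differentiation of integrals and absolute continuity\<close>

text \<open>Lebesgue differentiation. The averages in \<open>integrable_ccontinuous_explicit\<close>
  run over cubes with lower corner \<open>x\<close>, which in dimension one are right-hand
  difference quotients; the same result for the reflected function supplies the left-hand
  ones.\<close>

lemma AE_indefinite_integral_has_derivative:
  fixes h :: "real \<Rightarrow> real"
  assumes "\<And>a b. h integrable_on {a..b}"
  shows "AE x in lborel. x > 0 \<longrightarrow> ((\<lambda>x. integral {0..x} h) has_real_derivative h x) (at x)"
proof -
  have h': "(\<lambda>x. h (- x)) integrable_on cbox a b" for a b
    using assms[of "-b" "-a"] Henstock_Kurzweil_Integration.integrable_reflect_real[where f = h and a = "- b" and b = "- a"] by simp
  obtain N where N: "negligible N" "\<And>x e. x \<notin> N \<Longrightarrow> 0 < e \<Longrightarrow>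
      \<exists>d>0. \<forall>t. 0 < t \<and> t < d \<longrightarrow> norm (integral (cbox x (x + t *\<^sub>R One)) h /\<^sub>R t ^ DIM(real) - h x) < e"
    using integrable_ccontinuous_explicit[of h] assms by auto
  obtain N' where N': "negligible N'" "\<And>x e. x \<notin> N' \<Longrightarrow> 0 < e \<Longrightarrow>
      \<exists>d>0. \<forall>t. 0 < t \<and> t < d \<longrightarrow> norm (integral (cbox x (x + t *\<^sub>R One)) (\<lambda>x. h (- x)) /\<^sub>R t ^ DIM(real) - h (- x)) < e"
    using integrable_ccontinuous_explicit[of "\<lambda>x. h (- x)"] h' by auto
  have deriv: "((\<lambda>x. integral {0..x} h) has_real_derivative h x) (at x)"
    if x: "x > 0" "x \<notin> N" "x \<notin> uminus ` N'" for x
    unfolding DERIV_def LIM_def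
  proof safe
    fix e :: real assume e: "e > 0"
    obtain d1 where d1: "d1 > 0" "\<And>t. 0 < t \<Longrightarrow> t < d1 \<Longrightarrow> \<bar>integral {x..x + t} h / t - h x\<bar> < e"
      using N(2)[OF x(2) e] by (auto simp: divide_inverse mult.commute)
    have "- x \<notin> N'" using x(3) by force
    from N'(2)[OF this e] obtain d2 where d2: "d2 > 0"
      "\<And>t. 0 < t \<Longrightarrow> t < d2 \<Longrightarrow> \<bar>integral {-x..-x + t} (\<lambda>x. h (- x)) / t - h x\<bar> < e"
      by (auto simp: divide_inverse mult.commute)
    have d2': "\<bar>integral {x - t..x} h / t - h x\<bar> < e" if "0 < t" "t < d2" for t
      using d2(2)[OF that] Henstock_Kurzweil_Integration.integral_reflect_real[of "x" "x - t" h] by simp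
    \<comment> \<open>The bound by \<open>x\<close> keeps \<open>x + t\<close> positive for negative
      \<open>t\<close>, so that the integrals starting at 0 can be split there.\<close>
    define d where "d = min x (min d1 d2)"
    have "dist ((integral {0..x + t} h - integral {0..x} h) / t) (h x) < e"
      if t: "t \<noteq> 0" "dist t 0 < d" for t
    proof (cases "t > 0")
      case True
      have "integral {0..x} h + integral {x..x + t} h = integral {0..x + t} h"
        using True x assms by (intro Henstock_Kurzweil_Integration.integral_combine) auto
      hence "integral {0..x + t} h - integral {0..x} h = integral {x..x + t} h" by simp
      thus ?thesis using d1(2)[of t] True t by (simp add: dist_real_def d_def)
    next
      case False
      have "integral {0..x + t} h + integral {x + t..x} h = integral {0..x} h"
        using False x t assms by (intro Henstock_Kurzweil_Integration.integral_combine) (auto simp: d_def)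
      hence "integral {0..x + t} h - integral {0..x} h = - integral {x - (- t)..x} h" by simp
      hence "(integral {0..x + t} h - integral {0..x} h) / t = integral {x - (- t)..x} h / (- t)"
        by simp
      thus ?thesis using d2'[of "- t"] False t by (simp add: dist_real_def d_def)
    qed
    moreover have "d > 0" using d1 d2 x by (simp add: d_def)
    ultimately show "\<exists>s>0. \<forall>xa. xa \<noteq> 0 \<and> dist xa 0 < s \<longrightarrow>
        dist ((integral {0..x + xa} h - integral {0..x} h) / xa) (h x) < e" by blast
  qed
  have "negligible (N \<union> uminus ` N')"
    using N(1) N'(1) by (intro negligible_Un negligible_differentiable_image_negligible)
      (auto intro!: differentiable_on_minus differentiable_on_ident)
  hence "AE x in lebesgue. x \<notin> N \<union> uminus ` N'"
    by (intro AE_not_in) (simp add: negligible_iff_null_sets)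
  hence "AE x in lborel. x \<notin> N \<union> uminus ` N'" by (simp add: AE_completion_iff)
  thus ?thesis by eventually_elim (use deriv in auto)
qed

text \<open>Absolute continuity is stated for families indexed by an initial segment of the
  naturals; a tagged division is a finite set of pairs, so a bijection with such a segment transfers
  the estimate.\<close>

lemma abs_cont_on_unit_finite:
  assumes "abs_cont_on_unit g" "e > 0"
  obtains d where "d > 0" "\<And>(P :: 'i set) a b. finite P \<Longrightarrow>
     (\<And>i. i \<in> P \<Longrightarrow> 0 \<le> a i \<and> a i \<le> b i \<and> b i \<le> 1) \<Longrightarrow>
     disjoint_family_on (\<lambda>i. {a i<..<b i}) P \<Longrightarrow> (\<Sum>i\<in>P. b i - a i) < d \<Longrightarrow>
     (\<Sum>i\<in>P. \<bar>g (b i) - g (a i)\<bar>) < e"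
proof -
  from assms obtain d where d: "d > 0" "\<And>(n::nat) a b.
        (\<forall>i<n. 0 \<le> a i \<and> a i \<le> b i \<and> b i \<le> 1) \<Longrightarrow>
        disjoint_family_on (\<lambda>i. {a i<..<b i}) {..<n} \<Longrightarrow>
        (\<Sum>i<n. b i - a i) < d \<Longrightarrow>
        (\<Sum>i<n. \<bar>g (b i) - g (a i)\<bar>) < e"
    unfolding abs_cont_on_unit_def by blast
  show ?thesis
  proof (rule that[OF d(1)])
    fix P and a b :: "'i \<Rightarrow> real"
    assume P: "finite P" and ab: "\<And>i. i \<in> P \<Longrightarrow> 0 \<le> a i \<and> a i \<le> b i \<and> b i \<le> 1"
      and disj: "disjoint_family_on (\<lambda>i. {a i<..<b i}) P" and less: "(\<Sum>i\<in>P. b i - a i) < d"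
    obtain \<phi> where \<phi>: "bij_betw \<phi> {..<card P} P"
      using ex_bij_betw_nat_finite[OF P] by (auto simp: atLeast0LessThan)
    have inP: "\<phi> i \<in> P" if "i < card P" for i using \<phi> that by (auto simp: bij_betw_def)
    have "(\<Sum>i<card P. \<bar>g ((b \<circ> \<phi>) i) - g ((a \<circ> \<phi>) i)\<bar>) < e"
    proof (rule d(2))
      show "disjoint_family_on (\<lambda>i. {(a \<circ> \<phi>) i<..<(b \<circ> \<phi>) i}) {..<card P}"
        unfolding disjoint_family_on_def
      proof (intro ballI impI)
        fix i j assume "i \<in> {..<card P}" "j \<in> {..<card P}" "i \<noteq> j"
        moreover from this have "\<phi> i \<noteq> \<phi> j" using \<phi> by (auto simp: bij_betw_def inj_on_def)
        ultimately show "{(a \<circ> \<phi>) i<..<(b \<circ> \<phi>) i} \<inter> {(a \<circ> \<phi>) j<..<(b \<circ> \<phi>) j} = {}"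
          using disj inP unfolding disjoint_family_on_def by simp
      qed
      show "(\<Sum>i<card P. (b \<circ> \<phi>) i - (a \<circ> \<phi>) i) < d"
        using less sum.reindex_bij_betw[OF \<phi>, of "\<lambda>i. b i - a i"] by simp
    qed (use ab inP in auto)
    thus "(\<Sum>i\<in>P. \<bar>g (b i) - g (a i)\<bar>) < e"
      using sum.reindex_bij_betw[OF \<phi>, of "\<lambda>i. \<bar>g (b i) - g (a i)\<bar>"] by simp
  qed
qed

text \<open>The gauge integral fits because a Riemann sum of the derivative can be compared term by
  term with the telescoping sum of increments of \<open>g\<close>; integrability of \<open>h\<close>
  then comes out as part of the conclusion.\<close>

lemma abs_cont_has_integral_derivative:
  fixes g h :: "real \<Rightarrow> real"
  assumes ac: "abs_cont_on_unit g"
    and deriv: "AE x in lborel. x \<in> {0..1} \<longrightarrow> (g has_real_derivative h x) (at x)"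
    and ab: "0 \<le> a" "a \<le> b" "b \<le> 1"
  shows "(h has_integral g b - g a) {a..b}"
proof -
  define N where "N = {x. \<not> (x \<in> {0..1} \<longrightarrow> (g has_real_derivative h x) (at x))}"
  have N_null: "N \<in> null_sets lebesgue"
    using deriv unfolding N_def by (subst (asm) AE_completion_iff[symmetric])
      (simp add: completion.AE_iff_null_sets)
  \<comment> \<open>With value 0 on \<open>N\<close>, an interval tagged in \<open>N\<close>
    contributes nothing but an increment of \<open>g\<close>. The change is undone at the end by
    \<open>has_integral_spike\<close>.\<close>
  define h0 where "h0 = (\<lambda>x. if x \<in> N then 0 else h x)"
  have "(h0 has_integral g b - g a) {a..b}"
    unfolding has_integral_real
  proof (intro allI impI)
    fix e :: real assume e: "e > 0"
    \<comment> \<open>As \<open>b - a\<close> is at most 1, the intervals tagged outside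
      \<open>N\<close> cost at most \<open>e / 4\<close>; those tagged in \<open>N\<close> will cost
      less than \<open>e / 2\<close>.\<close>
    define \<eta> where "\<eta> = e / 4"
    have \<eta>: "\<eta> > 0" "\<eta> * (b - a) \<le> e / 4" using e ab by (auto simp: \<eta>_def mult_left_le)
    obtain \<delta> where \<delta>: "\<delta> > 0" "\<And>P u v. finite P \<Longrightarrow>
        (\<And>i. i \<in> P \<Longrightarrow> 0 \<le> u i \<and> u i \<le> v i \<and> v i \<le> 1) \<Longrightarrow>
        disjoint_family_on (\<lambda>i :: real \<times> real set. {u i<..<v i}) P \<Longrightarrow>
        (\<Sum>i\<in>P. v i - u i) < \<delta> \<Longrightarrow> (\<Sum>i\<in>P. \<bar>g (v i) - g (u i)\<bar>) < e / 2"
      using abs_cont_on_unit_finite[OF ac, where 'i = "real \<times> real set", OF half_gt_zero[OF e]] by blast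
    \<comment> \<open>Outer regularity: the null set \<open>N\<close> has an open cover whose
      measure is below the modulus of absolute continuity belonging to \<open>e / 2\<close>.\<close>
    obtain U where U: "open U" "N \<subseteq> U" "emeasure lebesgue (U - N) < ennreal \<delta>"
      using sets_lebesgue_outer_open[OF null_setsD2[OF N_null] \<delta>(1)] by metis
    have U_sets: "U \<in> sets lebesgue" using U(1) by auto
    have "emeasure lebesgue U = emeasure lebesgue (U - N)"
      using emeasure_Diff_null_set[OF N_null U_sets] by simp
    with U(3) have U_small: "emeasure lebesgue U < ennreal \<delta>" by simp
    have "\<exists>d>0. x \<notin> N \<longrightarrow> x \<in> {a..b} \<longrightarrow>
        (\<forall>y. norm (y - x) < d \<longrightarrow> norm (g y - g x - (y - x) * h x) \<le> \<eta> * norm (y - x))" for x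
    proof (cases "x \<notin> N \<and> x \<in> {a..b}")
      case True
      hence "(g has_real_derivative h x) (at x)" using ab by (auto simp: N_def)
      thus ?thesis using \<eta>(1) unfolding has_field_derivative_def has_derivative_at_alt
        by (simp add: mult.commute) blast
    qed (auto intro: exI[of _ 1])
    then obtain d where d: "\<And>x. 0 < d x" "\<And>x y. x \<notin> N \<Longrightarrow> x \<in> {a..b} \<Longrightarrow> norm (y - x) < d x \<Longrightarrow>
         norm (g y - g x - (y - x) * h x) \<le> \<eta> * norm (y - x)"
      by metis
    \<comment> \<open>Intervals tagged in the null set \<open>N\<close> lie in the small open set \<open>U\<close>, so absolute continuity
      controls their increments; the other intervals satisfy the straddle estimate.\<close>
    define \<gamma> where "\<gamma> = (\<lambda>x. if x \<in> N then U else ball x (d x))"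
    have gauge: "gauge \<gamma>" using U d(1) by (auto simp: gauge_def \<gamma>_def)
    have riemann: "norm ((\<Sum>(x, K)\<in>p. measure lborel K *\<^sub>R h0 x) - (g b - g a)) < e"
      if ptag: "p tagged_division_of {a..b}" and fine: "\<gamma> fine p" for p
    proof -
      have ba: "b - a = (\<Sum>(x,K)\<in>p. Sup K - Inf K)" "g b - g a = (\<Sum>(x,K)\<in>p. g (Sup K) - g (Inf K))"
        using additive_tagged_division_1[where f= "\<lambda>x. x"] additive_tagged_division_1[where f= g]
          \<open>a \<le> b\<close> ptag by auto
      have fin: "finite p" using ptag by blast
      have ends: "x \<in> K \<and> Inf K \<le> Sup K \<and> K = {Inf K..Sup K} \<and> a \<le> Inf K \<and> Sup K \<le> b \<and>
          measure lborel K = Sup K - Inf K \<and> interior K = {Inf K<..<Sup K}"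
        if "(x, K) \<in> p" for x K
      proof -
        have xK: "x \<in> K" "K \<subseteq> {a..b}" using ptag that by blast+
        have "\<exists>u v. K = cbox u v" using tagged_division_ofD(4)[OF ptag that] .
        then obtain u v where uv: "K = {u..v}" by auto
        hence "u \<le> v" using xK by auto
        thus ?thesis using xK uv by auto
      qed
      define p1 where "p1 = {q \<in> p. fst q \<in> N}"
      define p2 where "p2 = {q \<in> p. fst q \<notin> N}"
      have p: "p = p1 \<union> p2" "p1 \<inter> p2 = {}" "finite p1" "finite p2"
        using fin by (auto simp: p1_def p2_def)
      define F where "F = (\<lambda>(x, K). measure lborel K *\<^sub>R h0 x - (g (Sup K) - g (Inf K)))"
      have "(\<Sum>(x, K)\<in>p. measure lborel K *\<^sub>R h0 x) - (g b - g a) = sum F p"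
        unfolding ba F_def by (simp add: split_def sum_subtractf)
      also have "\<dots> = sum F p1 + sum F p2" using p by (simp add: sum.union_disjoint)
      finally have split: "(\<Sum>(x, K)\<in>p. measure lborel K *\<^sub>R h0 x) - (g b - g a) = sum F p1 + sum F p2" .
      have disj: "disjoint_family_on (\<lambda>q. {Inf (snd q)<..<Sup (snd q)}) p1"
        unfolding disjoint_family_on_def
      proof (intro ballI impI)
        fix q r assume qr: "q \<in> p1" "r \<in> p1" "q \<noteq> r"
        obtain x K y L where [simp]: "q = (x, K)" "r = (y, L)" by (metis surj_pair)
        have "interior K \<inter> interior L = {}"
          using tagged_division_ofD(5)[OF ptag, of x K y L] qr by (auto simp: p1_def)
        moreover have "interior K = {Inf K<..<Sup K}" "interior L = {Inf L<..<Sup L}"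
          using ends[of x K] ends[of y L] qr unfolding p1_def by simp_all
        ultimately show "{Inf (snd q)<..<Sup (snd q)} \<inter> {Inf (snd r)<..<Sup (snd r)} = {}" by simp
      qed
      have "norm (sum F p1) \<le> (\<Sum>q\<in>p1. \<bar>g (Sup (snd q)) - g (Inf (snd q))\<bar>)"
        by (rule sum_norm_le) (auto simp: F_def p1_def h0_def)
      also have "\<dots> < e / 2"
      proof (rule \<delta>(2))
        show "0 \<le> Inf (snd i) \<and> Inf (snd i) \<le> Sup (snd i) \<and> Sup (snd i) \<le> 1" if "i \<in> p1" for i
          using ends[of "fst i" "snd i"] that ab by (auto simp: p1_def)
        \<comment> \<open>The open intervals are disjoint, so their total length is the measure of
          their union, which the gauge confines to \<open>U\<close>.\<close>
        have "ennreal (\<Sum>q\<in>p1. Sup (snd q) - Inf (snd q)) =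
            (\<Sum>q\<in>p1. emeasure lebesgue {Inf (snd q)<..<Sup (snd q)})"
          using ends by (subst sum_ennreal[symmetric]) (auto simp: p1_def intro!: sum.cong)
        also have "\<dots> = emeasure lebesgue (\<Union>q\<in>p1. {Inf (snd q)<..<Sup (snd q)})"
          by (rule sum_emeasure) (use p disj in auto)
        also have "\<dots> \<le> emeasure lebesgue U"
        proof (rule emeasure_mono)
          show "(\<Union>q\<in>p1. {Inf (snd q)<..<Sup (snd q)}) \<subseteq> U"
          proof safe
            fix z x K assume q: "(x, K) \<in> p1" "z \<in> {Inf (snd (x, K))<..<Sup (snd (x, K))}"
            hence "(x, K) \<in> p" "x \<in> N" by (auto simp: p1_def)
            hence "K \<subseteq> U" using fineD[OF fine \<open>(x, K) \<in> p\<close>] by (simp add: \<gamma>_def)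
            moreover have "z \<in> {Inf K..Sup K}" using q by auto
            ultimately show "z \<in> U" using q ends[of x K] by (auto simp: p1_def)
          qed
        qed (use U in auto)
        also have "\<dots> < ennreal \<delta>" by (rule U_small)
        finally show "(\<Sum>q\<in>p1. Sup (snd q) - Inf (snd q)) < \<delta>"
          using ennreal_leI leD not_le by metis
      qed (use p disj in auto)
      finally have 1: "norm (sum F p1) < e / 2" .
      have "norm (sum F p2) \<le> (\<Sum>q\<in>p2. \<eta> * (Sup (snd q) - Inf (snd q)))"
      proof (rule sum_norm_le)
        fix q assume "q \<in> p2"
        then obtain x K where q: "q = (x, K)" "(x, K) \<in> p" "x \<notin> N" by (cases q) (auto simp: p2_def)
        define u v where "u = Inf K" and "v = Sup K"
        have K: "x \<in> {u..v}" "K = {u..v}" "a \<le> u" "v \<le> b" "measure lborel K = v - u"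
          using ends[OF q(2)] by (auto simp: u_def v_def)
        have "K \<subseteq> ball x (d x)" using fineD[OF fine q(2)] q(3) by (simp add: \<gamma>_def)
        moreover have "u \<in> K" "v \<in> K" using K by auto
        ultimately have "norm (u - x) < d x" "norm (v - x) < d x" by (auto simp: dist_real_def)
        hence "norm (g u - g x - (u - x) * h x) \<le> \<eta> * norm (u - x)"
              "norm (g v - g x - (v - x) * h x) \<le> \<eta> * norm (v - x)"
          using K ab by (auto intro!: d(2)[OF q(3)] simp del: real_norm_def)
        \<comment> \<open>The tag lies between the endpoints, so its two distances add up to the
          length of the interval; \<open>F q\<close> is the difference of the two linearisation
          errors at the endpoints.\<close>
        moreover have "\<eta> * norm (u - x) + \<eta> * norm (v - x) = \<eta> * (v - u)"
          using K by (simp add: algebra_simps)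
        moreover have "F q = (g u - g x - (u - x) * h x) - (g v - g x - (v - x) * h x)"
          using q K by (simp add: F_def h0_def u_def[symmetric] v_def[symmetric] algebra_simps)
        ultimately have "norm (F q) \<le> \<eta> * (v - u)" unfolding real_norm_def by linarith
        thus "norm (F q) \<le> \<eta> * (Sup (snd q) - Inf (snd q))" by (simp add: q u_def v_def)
      qed
      also have "\<dots> \<le> (\<Sum>q\<in>p. \<eta> * (Sup (snd q) - Inf (snd q)))"
      proof (rule sum_mono2[OF fin])
        fix q assume "q \<in> p - p2"
        hence "Inf (snd q) \<le> Sup (snd q)" using ends[of "fst q" "snd q"] by simp
        thus "0 \<le> \<eta> * (Sup (snd q) - Inf (snd q))" using \<eta>(1) by simp
      qed (use p in blast)
      also have "\<dots> = \<eta> * (b - a)" unfolding ba by (simp add: sum_distrib_left split_def)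
      finally have 2: "norm (sum F p2) \<le> e / 4" using \<eta>(2) by simp
      show ?thesis unfolding split using 1 2 norm_triangle_ineq[of "sum F p1" "sum F p2"] e by simp
    qed
    show "\<exists>\<gamma>. gauge \<gamma> \<and> (\<forall>\<D>. \<D> tagged_division_of {a..b} \<and> \<gamma> fine \<D> \<longrightarrow>
         norm ((\<Sum>(x, K)\<in>\<D>. measure lborel K *\<^sub>R h0 x) - (g b - g a)) < e)"
      using gauge riemann by (intro exI[of _ \<gamma>]) simp
  qed
  moreover have "negligible N" using N_null by (simp add: negligible_iff_null_sets)
  ultimately show ?thesis
    by (rule has_integral_spike[rotated 2]) (auto simp: h0_def)
qed

section \<open>Left-sided integrals of continuous functions\<close>

text \<open>A strict violation at one point would persist on a nondegenerate interval, which is not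
  a null set. This is the passage from almost everywhere to everywhere for representatives.\<close>

lemma continuous_AE_le:
  fixes f g :: "real \<Rightarrow> real"
  assumes cont: "continuous_on {0..1} f" "continuous_on {0..1} g"
    and AE: "AE x in lborel. x \<in> {0..1} \<longrightarrow> f x \<le> g x"
    and t: "t \<in> {0..1}"
  shows "f t \<le> g t"
proof (rule ccontr)
  assume less: "\<not> f t \<le> g t"
  have "continuous_on {0..1} (\<lambda>x. f x - g x)" using cont by (intro continuous_intros)
  then obtain d where d: "d > 0" "\<And>x. x \<in> {0..1} \<Longrightarrow> dist x t < d \<Longrightarrow>
      dist (f x - g x) (f t - g t) < f t - g t"
    using t less unfolding continuous_on_iff by (metis diff_gt_0_iff_gt not_le)
  \<comment> \<open>Clipping to [0,1] leaves an interval of positive length even when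
    \<open>t\<close> is an endpoint.\<close>
  define l r where "l = max 0 (t - d)" and "r = min 1 (t + d)"
  have "l < r" using t d by (auto simp: l_def r_def)
  have "AE x in lborel. x \<notin> {l<..<r}"
    using AE
  proof eventually_elim
    case (elim x)
    show ?case
    proof
      assume "x \<in> {l<..<r}"
      hence "x \<in> {0..1}" "dist x t < d" by (auto simp: l_def r_def dist_real_def)
      with d(2)[of x] elim show False by (auto simp: dist_real_def)
    qed
  qed
  hence "{l<..<r} \<in> null_sets lborel" by (simp add: AE_iff_null_sets)
  hence "emeasure lborel {l<..<r} = 0" by auto
  thus False using \<open>l < r\<close> by simp
qed

lemma continuous_AE_eq:
  fixes f g :: "real \<Rightarrow> real"
  assumes "continuous_on {0..1} f" "continuous_on {0..1} g"
    and "AE x in lborel. x \<in> {0..1} \<longrightarrow> f x = g x" and "t \<in> {0..1}"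
  shows "f t = g t"
proof (rule antisym)
  show "f t \<le> g t" using assms(3) by (intro continuous_AE_le[OF assms(1,2) _ assms(4)]) (auto elim: eventually_mono)
  show "g t \<le> f t" using assms(3) by (intro continuous_AE_le[OF assms(2,1) _ assms(4)]) (auto elim: eventually_mono)
qed

lemma abs_cont_imp_continuous:
  assumes "abs_cont_on_unit g"
  shows "continuous_on {0..1} g"
  unfolding continuous_on_iff
proof (intro ballI allI impI)
  fix x e :: real assume x: "x \<in> {0..1}" and e: "e > 0"
  obtain d where d: "d > 0" "\<And>(P :: unit set) a b. finite P \<Longrightarrow>
     (\<And>i. i \<in> P \<Longrightarrow> 0 \<le> a i \<and> a i \<le> b i \<and> b i \<le> 1) \<Longrightarrow>
     disjoint_family_on (\<lambda>i. {a i<..<b i}) P \<Longrightarrow> (\<Sum>i\<in>P. b i - a i) < d \<Longrightarrow>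
     (\<Sum>i\<in>P. \<bar>g (b i) - g (a i)\<bar>) < e"
    using abs_cont_on_unit_finite[OF assms e, where 'i = unit] by blast
  have "dist (g y) (g x) < e" if y: "y \<in> {0..1}" "dist y x < d" for y
    using d(2)[of "{()}" "\<lambda>_. min x y" "\<lambda>_. max x y"] x y
    by (cases "x \<le> y") (auto simp: dist_real_def disjoint_family_on_def min_def max_def split: if_splits)
  thus "\<exists>d>0. \<forall>y\<in>{0..1}. dist y x < d \<longrightarrow> dist (g y) (g x) < e"
    using d(1) by blast
qed

text \<open>This allows a representative to replace an integral inside another left-sided
  integral.\<close>

lemma left_integral_cong_AE:
  assumes "AE y in lborel. y \<in> {0..1} \<longrightarrow> \<phi> y = \<psi> y" and "x \<in> {0..1}"
  shows "left_integral w k \<phi> x = left_integral w k \<psi> x"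
  unfolding left_integral_def set_lebesgue_integral_def
proof (rule integral_cong_AE_lebesgue)
  show "AE y in lborel. indicator {0..<x} y *\<^sub>R (k x y * \<phi> y * w y) =
                        indicator {0..<x} y *\<^sub>R (k x y * \<psi> y * w y)"
    using assms(1) by eventually_elim (use assms(2) in \<open>auto simp: indicator_def\<close>)
qed

lemma continuous_bounded_unit:
  fixes \<phi> :: "real \<Rightarrow> real"
  assumes "continuous_on {0..1} \<phi>"
  obtains B where "B > 0" "\<And>x. x \<in> {0..1} \<Longrightarrow> \<bar>\<phi> x\<bar> \<le> B"
proof -
  have "bounded (\<phi> ` {0..1})"
    using assms by (intro compact_imp_bounded compact_continuous_image) auto
  then obtain B where "B > 0" "\<forall>y\<in>\<phi> ` {0..1}. norm y \<le> B" by (auto simp: bounded_pos)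
  thus ?thesis by (intro that[of B]) auto
qed

lemma left_integral_integrable:
  assumes k: "k \<in> kernel_class w" and \<phi>: "continuous_on {0..1} \<phi>"
  shows "AE x in lborel. x \<in> {0..1} \<longrightarrow> set_integrable lebesgue {0..<x} (\<lambda>y. k x y * \<phi> y * w y)"
proof -
  obtain B where B: "B > 0" "\<And>x. x \<in> {0..1} \<Longrightarrow> \<bar>\<phi> x\<bar> \<le> B"
    using continuous_bounded_unit[OF \<phi>] by blast
  have "\<phi> \<in> borel_measurable (lebesgue_on {0..1})"
    using \<phi> by (intro continuous_imp_measurable_on_sets_lebesgue) auto
  hence \<phi>_meas: "(\<lambda>y. if y \<in> {0..1} then \<phi> y else 0) \<in> borel_measurable lebesgue"
    by (subst borel_measurable_if) auto
  have int: "AE x in lborel. x \<in> {0<..1} \<longrightarrow> set_integrable lebesgue {0..<x} (\<lambda>z. k x z * w z)"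
    using k by (subst AE_lebesgue_on_iff[symmetric]) (auto simp: kernel_class_def)
  have "AE x in lborel. x \<noteq> (0::real)" by (rule AE_lborel_singleton)
  with int show ?thesis
  proof eventually_elim
    case (elim x)
    show ?case
    proof
      assume x: "x \<in> {0..1}"
      have i: "integrable lebesgue (\<lambda>y. indicator {0..<x} y * (k x y * w y))"
        using elim x by (auto simp: set_integrable_def)
      have "integrable lebesgue (\<lambda>y. (if y \<in> {0..1} then \<phi> y else 0) * (indicator {0..<x} y * (k x y * w y)))"
      proof (rule Bochner_Integration.integrable_bound)
        show "integrable lebesgue (\<lambda>y. B * (indicator {0..<x} y * (k x y * w y)))" using i by simp
        show "(\<lambda>y. (if y \<in> {0..1} then \<phi> y else 0) * (indicator {0..<x} y * (k x y * w y)))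
          \<in> borel_measurable lebesgue"
          using \<phi>_meas borel_measurable_integrable[OF i] by (rule borel_measurable_times)
        show "AE y in lebesgue. norm ((if y \<in> {0..1} then \<phi> y else 0) * (indicator {0..<x} y * (k x y * w y)))
           \<le> norm (B * (indicator {0..<x} y * (k x y * w y)))"
          using B by (intro AE_I2) (auto simp: abs_mult intro!: mult_right_mono)
      qed
      also have "(\<lambda>y. (if y \<in> {0..1} then \<phi> y else 0) * (indicator {0..<x} y * (k x y * w y))) =
          (\<lambda>y. indicator {0..<x} y *\<^sub>R (k x y * \<phi> y * w y))"
        using x by (auto simp: fun_eq_iff indicator_def)
      finally show "set_integrable lebesgue {0..<x} (\<lambda>y. k x y * \<phi> y * w y)"
        by (simp add: set_integrable_def)
    qed
  qed
qed

text \<open>The integral of a non-integrable function is 0 by convention, so additivity can fail at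
  individual points; it holds at those \<open>x\<close> where both integrands are
  integrable.\<close>

lemma left_integral_diff_AE:
  assumes k: "k \<in> kernel_class w" and "continuous_on {0..1} \<phi>" "continuous_on {0..1} \<psi>"
  shows "AE x in lborel. x \<in> {0..1} \<longrightarrow>
     left_integral w k (\<lambda>y. \<phi> y - \<psi> y) x = left_integral w k \<phi> x - left_integral w k \<psi> x"
  using left_integral_integrable[OF k assms(2)] left_integral_integrable[OF k assms(3)]
proof eventually_elim
  case (elim x)
  show ?case
  proof
    assume "x \<in> {0..1}"
    with elim have "left_integral w k \<phi> x - left_integral w k \<psi> x =
       (LINT y:{0..<x}|lebesgue. k x y * \<phi> y * w y - k x y * \<psi> y * w y)"
      unfolding left_integral_def by (subst set_integral_diff) auto
    thus "left_integral w k (\<lambda>y. \<phi> y - \<psi> y) x = left_integral w k \<phi> x - left_integral w k \<psi> x"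
      by (simp add: left_integral_def algebra_simps)
  qed
qed

text \<open>Positivity of kernel and weight lets the bound of \<open>\<phi>\<close> be pulled out;
  this is the origin of the k-integral of 1 in the contraction constant.\<close>

lemma left_integral_bound_AE:
  assumes weight: "weight_function w" and k: "k \<in> kernel_class w" and \<phi>: "continuous_on {0..1} \<phi>"
    and B: "\<And>x. x \<in> {0..1} \<Longrightarrow> \<bar>\<phi> x\<bar> \<le> B"
  shows "AE x in lborel. x \<in> {0..1} \<longrightarrow> \<bar>left_integral w k \<phi> x\<bar> \<le> B * left_integral w k (\<lambda>_. 1) x"
  using left_integral_integrable[OF k \<phi>] left_integral_integrable[OF k continuous_on_const[of _ 1]]
proof eventually_elim
  case (elim x)
  show ?case
  proof
    assume x: "x \<in> {0..1}"
    have "\<bar>left_integral w k \<phi> x\<bar> \<le> (\<integral>y. \<bar>indicator {0..<x} y *\<^sub>R (k x y * \<phi> y * w y)\<bar> \<partial>lebesgue)"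
      unfolding left_integral_def set_lebesgue_integral_def by (rule integral_abs_bound)
    also have "\<dots> \<le> (\<integral>y. B * (indicator {0..<x} y *\<^sub>R (k x y * 1 * w y)) \<partial>lebesgue)"
    proof (rule integral_mono)
      show "integrable lebesgue (\<lambda>y. \<bar>indicator {0..<x} y *\<^sub>R (k x y * \<phi> y * w y)\<bar>)"
        using elim(1) x unfolding set_integrable_def by (intro integrable_abs) blast
      show "integrable lebesgue (\<lambda>y. B * (indicator {0..<x} y *\<^sub>R (k x y * 1 * w y)))"
        using elim(2) x unfolding set_integrable_def by (intro integrable_mult_right) blast
      fix y
      show "\<bar>indicator {0..<x} y *\<^sub>R (k x y * \<phi> y * w y)\<bar> \<le> B * (indicator {0..<x} y *\<^sub>R (k x y * 1 * w y))"
      proof (cases "y \<in> {0..<x}")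
        case True
        hence "(x, y) \<in> Omega" "y \<in> {0..1}" using x by (auto simp: Omega_def)
        hence "k x y > 0" "w y > 0" "\<bar>\<phi> y\<bar> \<le> B"
          using k weight B by (auto simp: kernel_class_def weight_function_def)
        hence "\<bar>\<phi> y\<bar> * (k x y * w y) \<le> B * (k x y * w y)" by (intro mult_right_mono) auto
        thus ?thesis using True \<open>k x y > 0\<close> \<open>w y > 0\<close> by (simp add: abs_mult mult_ac)
      qed auto
    qed
    also have "\<dots> = B * left_integral w k (\<lambda>_. 1) x"
      by (simp add: left_integral_def set_lebesgue_integral_def)
    finally show "\<bar>left_integral w k \<phi> x\<bar> \<le> B * left_integral w k (\<lambda>_. 1) x" .
  qed
qed

text \<open>The operator J. The indicator makes the integrand integrable over every real interval,
  as the differentiation lemma demands, whatever \<open>w\<close> is outside [0,1]; the gauge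
  integral matches the form of the fundamental theorem above.\<close>

definition primitive :: "(real \<Rightarrow> real) \<Rightarrow> (real \<Rightarrow> real) \<Rightarrow> real \<Rightarrow> real" where
  "primitive w \<phi> x = integral {0..x} (\<lambda>y. indicator {0..1} y * (\<phi> y * w y))"

lemma primitive_0 [simp]: "primitive w \<phi> 0 = 0"
  by (simp add: primitive_def)

section \<open>Integrability, absolute continuity and differentiation of weighted primitives\<close>

context
  fixes w \<phi> :: "real \<Rightarrow> real"
  assumes weight: "weight_function w" and \<phi>: "continuous_on {0..1} \<phi>"
begin

lemma weighted_integrable:
  obtains M where "M > 0" "integrable lebesgue (\<lambda>y. indicator {0..1} y * (\<phi> y * w y))"
    "AE y in lebesgue. \<bar>indicator {0..1} y * (\<phi> y * w y)\<bar> \<le> M * indicator {0..1} y"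
proof -
  obtain B where B: "B > 0" "\<And>x. x \<in> {0..1} \<Longrightarrow> \<bar>\<phi> x\<bar> \<le> B"
    using continuous_bounded_unit[OF \<phi>] by blast
  have w: "w \<in> borel_measurable (lebesgue_on {0..1})" "\<exists>C. AE x in lebesgue_on {0..1}. \<bar>w x\<bar> \<le> C"
    using weight by (auto simp: weight_function_def Linfty_on_def)
  then obtain C where C: "AE x in lborel. x \<in> {0..1} \<longrightarrow> \<bar>w x\<bar> \<le> C"
    by (auto simp: AE_lebesgue_on_iff)
  \<comment> \<open>The maximum with 1 secures \<open>M > 0\<close>, since \<open>M\<close> later
    serves as a Lipschitz constant and as a divisor.\<close>
  define M where "M = B * max C 1"
  have M: "M > 0" using B by (simp add: M_def)
  have bound: "AE y in lebesgue. \<bar>indicator {0..1} y * (\<phi> y * w y)\<bar> \<le> M * indicator {0..1} y"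
    unfolding AE_completion_iff using C
  proof eventually_elim
    case (elim y)
    thus ?case using B by (auto simp: M_def abs_mult indicator_def intro!: mult_mono)
  qed
  have "\<phi> \<in> borel_measurable (lebesgue_on {0..1})"
    using \<phi> by (intro continuous_imp_measurable_on_sets_lebesgue) auto
  hence "(\<lambda>y. if y \<in> {0..1} then \<phi> y * w y else 0) \<in> borel_measurable lebesgue"
    using w by (subst borel_measurable_if) auto
  also have "(\<lambda>y. if y \<in> {0..1} then \<phi> y * w y else 0) = (\<lambda>y. indicator {0..1} y * (\<phi> y * w y))"
    by (auto simp: fun_eq_iff)
  finally have meas: "(\<lambda>y. indicator {0..1} y * (\<phi> y * w y)) \<in> borel_measurable lebesgue" .
  have "integrable lebesgue (\<lambda>y. M * indicator {0..1::real} y)" by simp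
  hence "integrable lebesgue (\<lambda>y. indicator {0..1} y * (\<phi> y * w y))"
    using meas by (rule Bochner_Integration.integrable_bound)
      (use bound in eventually_elim, use M in auto)
  with M bound show ?thesis by (intro that[of M])
qed

lemma weighted_set_integrable:
  assumes "S \<in> sets lebesgue"
  shows "set_integrable lebesgue S (\<lambda>y. indicator {0..1} y * (\<phi> y * w y))"
proof -
  obtain M where "integrable lebesgue (\<lambda>y. indicator {0..1} y * (\<phi> y * w y))"
    using weighted_integrable by blast
  thus ?thesis using assms unfolding set_integrable_def by (intro integrable_mult_indicator)
qed

lemma weighted_integrable_on: "(\<lambda>y. indicator {0..1} y * (\<phi> y * w y)) integrable_on {a..b}"
  using weighted_set_integrable[of "{a..b}"] by (intro set_lebesgue_integral_eq_integral) auto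

lemma set_lebesgue_integral_eq_primitive:
  assumes "x \<in> {0..1}"
  shows "(LINT y:{0..<x}|lebesgue. \<phi> y * w y) = primitive w \<phi> x"
proof -
  have "(LINT y:{0..<x}|lebesgue. \<phi> y * w y) =
        (LINT y:{0..<x}|lebesgue. indicator {0..1} y * (\<phi> y * w y))"
    using assms by (intro set_lebesgue_integral_cong) auto
  also have "\<dots> = integral {0..<x} (\<lambda>y. indicator {0..1} y * (\<phi> y * w y))"
    by (intro set_lebesgue_integral_eq_integral weighted_set_integrable) auto
  also have "\<dots> = primitive w \<phi> x"
    unfolding primitive_def
    by (intro integral_subset_negligible negligible_subset[OF negligible_sing[of x]]) auto
  finally show ?thesis .
qed

text \<open>The primitive is Lipschitz, with the essential bound of the weighted integrand as its
  constant.\<close>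

lemma primitive_abs_cont: "abs_cont_on_unit (primitive w \<phi>)"
proof -
  let ?h = "\<lambda>y. indicator {0..1} y * (\<phi> y * w y)"
  obtain M where M: "M > 0" "integrable lebesgue ?h"
    "AE y in lebesgue. \<bar>?h y\<bar> \<le> M * indicator {0..1} y"
    using weighted_integrable by blast
  have lip: "\<bar>primitive w \<phi> b - primitive w \<phi> a\<bar> \<le> M * (b - a)" if ab: "0 \<le> a" "a \<le> b" for a b
  proof -
    have "integral {0..a} ?h + integral {a..b} ?h = integral {0..b} ?h"
      using ab weighted_integrable_on by (intro Henstock_Kurzweil_Integration.integral_combine)
    hence "primitive w \<phi> b - primitive w \<phi> a = integral {a..b} ?h" by (simp add: primitive_def)
    also have "\<dots> = (\<integral>y. indicator {a..b} y *\<^sub>R ?h y \<partial>lebesgue)"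
      using set_lebesgue_integral_eq_integral(2)[OF weighted_set_integrable[of "{a..b}"]]
      by (simp add: set_lebesgue_integral_def)
    finally have "\<bar>primitive w \<phi> b - primitive w \<phi> a\<bar> = \<bar>\<integral>y. indicator {a..b} y *\<^sub>R ?h y \<partial>lebesgue\<bar>" by simp
    also have "\<dots> \<le> (\<integral>y. \<bar>indicator {a..b} y *\<^sub>R ?h y\<bar> \<partial>lebesgue)" by (rule integral_abs_bound)
    also have "\<dots> \<le> (\<integral>y. M * indicator {a..b} y \<partial>lebesgue)"
    proof (rule integral_mono_AE)
      show "integrable lebesgue (\<lambda>y. \<bar>indicator {a..b} y *\<^sub>R ?h y\<bar>)"
        using weighted_set_integrable[of "{a..b}"] unfolding set_integrable_def
        by (intro integrable_abs) auto
      show "AE y in lebesgue. \<bar>indicator {a..b} y *\<^sub>R ?h y\<bar> \<le> M * indicator {a..b} y"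
        using M(3) by eventually_elim (use M(1) in \<open>auto simp: indicator_def split: if_splits\<close>)
      show "integrable lebesgue (\<lambda>y. M * indicator {a..b} y)"
        using ab by (intro integrable_mult_right integrable_real_indicator) auto
    qed
    also have "\<dots> = M * (b - a)" using ab by simp
    finally show ?thesis .
  qed
  show ?thesis
    unfolding abs_cont_on_unit_def
  proof (intro allI impI)
    fix e :: real assume "e > 0"
    show "\<exists>d>0. \<forall>(n::nat) a b. (\<forall>i<n. 0 \<le> a i \<and> a i \<le> b i \<and> b i \<le> 1) \<longrightarrow>
        disjoint_family_on (\<lambda>i. {a i<..<b i}) {..<n} \<longrightarrow> (\<Sum>i<n. b i - a i) < d \<longrightarrow>
        (\<Sum>i<n. \<bar>primitive w \<phi> (b i) - primitive w \<phi> (a i)\<bar>) < e"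
    proof (intro exI[of _ "e / M"] conjI allI impI)
      fix n :: nat and a b :: "nat \<Rightarrow> real"
      assume ab: "\<forall>i<n. 0 \<le> a i \<and> a i \<le> b i \<and> b i \<le> 1" and less: "(\<Sum>i<n. b i - a i) < e / M"
      have "(\<Sum>i<n. \<bar>primitive w \<phi> (b i) - primitive w \<phi> (a i)\<bar>) \<le> (\<Sum>i<n. M * (b i - a i))"
        using ab by (intro sum_mono lip) auto
      also have "\<dots> = M * (\<Sum>i<n. b i - a i)" by (simp add: sum_distrib_left)
      also have "\<dots> < e" using less M(1) by (simp add: field_simps)
      finally show "(\<Sum>i<n. \<bar>primitive w \<phi> (b i) - primitive w \<phi> (a i)\<bar>) < e" .
    qed (use M \<open>e > 0\<close> in auto)
  qed
qed

lemma primitive_has_derivative_AE: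
  "AE x in lborel. x \<in> {0..1} \<longrightarrow> (primitive w \<phi> has_real_derivative w x * \<phi> x) (at x)"
proof -
  have "AE x in lborel. x \<noteq> (0::real)" by (rule AE_lborel_singleton)
  with AE_indefinite_integral_has_derivative[OF weighted_integrable_on]
  show ?thesis
  proof eventually_elim
    case (elim x)
    show ?case
    proof
      assume "x \<in> {0..1}"
      hence "x > 0" and eq: "indicator {0..1} x * (\<phi> x * w x) = w x * \<phi> x" using elim by auto
      from elim(1)[rule_format, OF \<open>x > 0\<close>]
      show "(primitive w \<phi> has_real_derivative w x * \<phi> x) (at x)"
        unfolding eq primitive_def[abs_def] .
    qed
  qed
qed

end

section \<open>The fixed point problem\<close>

lemma is_cont_rep_iff:
  "is_cont_rep h g \<longleftrightarrow> continuous_on {0..1} g \<and> (AE x in lborel. x \<in> {0..1} \<longrightarrow> h x = g x)"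
  by (simp add: is_cont_rep_def AE_lebesgue_on_iff)

lemma is_ac_rep_iff:
  "is_ac_rep h g \<longleftrightarrow> abs_cont_on_unit g \<and> (AE x in lborel. x \<in> {0..1} \<longrightarrow> h x = g x)"
  by (simp add: is_ac_rep_def AE_lebesgue_on_iff)

lemma left_integral_compose_primitive:
  assumes weight: "weight_function w"
    and "k1 \<in> kernel_class w" "k2 \<in> kernel_class w"
    and "\<And>x y. (x, y) \<in> Omega \<Longrightarrow> kernel_delta w k1 k2 x y = 1"
    and \<phi>: "continuous_on {0..1} \<phi>"
  shows "AE x in lborel. x \<in> {0..1} \<longrightarrow>
           left_integral w k1 (left_integral w k2 \<phi>) x = primitive w \<phi> x"
proof -
  obtain B where B: "\<And>x. x \<in> {0..1} \<Longrightarrow> \<bar>\<phi> x\<bar> \<le> B"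
    using continuous_bounded_unit[OF \<phi>] by blast
  have "\<phi> \<in> borel_measurable (lebesgue_on {0..1})"
    using \<phi> by (intro continuous_imp_measurable_on_sets_lebesgue) auto
  from left_integral_compose[OF assms(1-4) this B]
  have "AE x in lborel. x \<in> {0..1} \<longrightarrow>
      left_integral w k1 (left_integral w k2 \<phi>) x = (LINT y:{0..<x}|lebesgue. \<phi> y * w y)"
    by (simp add: AE_lebesgue_on_iff)
  thus ?thesis
    by eventually_elim (simp add: set_lebesgue_integral_eq_primitive[OF weight \<phi>])
qed

text \<open>Injectivity of J: the primitive is continuous, hence identically 0 on [0,1], so its
  derivative \<open>w x * \<phi> x\<close> vanishes almost everywhere, and the weight is
  positive.\<close>

lemma primitive_AE_0_imp_AE_0:
  assumes weight: "weight_function w" and \<phi>: "continuous_on {0..1} \<phi>"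
    and zero: "AE x in lborel. x \<in> {0..1} \<longrightarrow> primitive w \<phi> x = 0"
  shows "AE x in lborel. x \<in> {0..1} \<longrightarrow> \<phi> x = 0"
proof -
  have zero': "primitive w \<phi> x = 0" if "x \<in> {0..1}" for x
    using continuous_AE_eq[OF abs_cont_imp_continuous[OF primitive_abs_cont[OF weight \<phi>]] continuous_on_const zero that] .
  have "AE x in lborel. x \<noteq> (0::real)" "AE x in lborel. x \<noteq> (1::real)"
    by (rule AE_lborel_singleton)+
  with primitive_has_derivative_AE[OF weight \<phi>]
  show ?thesis
  proof eventually_elim
    case (elim x)
    show ?case
    proof
      assume x: "x \<in> {0..1}"
      hence "x \<in> {0<..<1}" using elim by auto
      with elim(1) x have "((\<lambda>_. 0) has_real_derivative w x * \<phi> x) (at x)"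
        by (rule has_field_derivative_transform_within_open[OF mp open_greaterThanLessThan])
          (use zero' in simp)
      hence "w x * \<phi> x = 0" using DERIV_unique[OF _ DERIV_const] by blast
      moreover have "w x > 0" using weight x by (simp add: weight_function_def)
      ultimately show "\<phi> x = 0" by simp
    qed
  qed
qed

lemma bvp_solution_iff_fixed_point:
  assumes weight: "weight_function w"
    and k: "k \<in> kernel_class w" and k': "k' \<in> kernel_class w"
    and conj: "conjugate_kernels w k k'"
    and f_cont: "continuous_on ({0..1} \<times> UNIV) (\<lambda>(t, x). f t x)"
    and A1: "\<And>y. continuous_on {0..1} y \<Longrightarrow> \<exists>g. is_cont_rep (left_integral w k y) g"
    and u: "continuous_on {0..1} u"
  shows "bvp_solution w k' f u \<longleftrightarrow>
    (AE x in lborel. x \<in> {0..1} \<longrightarrow> left_integral w k (\<lambda>t. f t (u t)) x = u x)"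
proof -
  define \<phi> where "\<phi> = (\<lambda>t. f t (u t))"
  have \<phi>: "continuous_on {0..1} \<phi>"
    unfolding \<phi>_def using u
    by (intro continuous_on_compose2[OF f_cont, of _ "\<lambda>t. (t, u t)", simplified] continuous_intros) auto
  have compose: "AE x in lborel. x \<in> {0..1} \<longrightarrow>
       left_integral w k' (left_integral w k \<psi>) x = primitive w \<psi> x"
    and compose': "AE x in lborel. x \<in> {0..1} \<longrightarrow>
       left_integral w k (left_integral w k' \<psi>) x = primitive w \<psi> x"
    if "continuous_on {0..1} \<psi>" for \<psi>
    using left_integral_compose_primitive[OF weight k' k _ that] left_integral_compose_primitive[OF weight k k' _ that]
      conj unfolding conjugate_kernels_def by blast+
  define g where "g = ac_rep (left_integral w k' u)"
  have g_rep: "is_ac_rep (left_integral w k' u) g" if "\<exists>g. is_ac_rep (left_integral w k' u) g"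
    unfolding g_def ac_rep_def using that by (rule someI_ex)
  have w_pos: "w x > 0" if "x \<in> {0..1}" for x
    using weight that by (simp add: weight_function_def)
  have fixed: "AE x in lborel. x \<in> {0..1} \<longrightarrow> left_integral w k \<phi> x = u x"
    if sol: "bvp_solution w k' f u"
  proof -
    have g: "is_ac_rep (left_integral w k' u) g"
      using sol by (intro g_rep) (auto simp: bvp_solution_def)
    have g_ac: "abs_cont_on_unit g" and g_AE: "AE x in lborel. x \<in> {0..1} \<longrightarrow> left_integral w k' u x = g x"
      using g by (auto simp: is_ac_rep_iff)
    have "AE t in lborel. t \<in> {0..1} \<longrightarrow> g differentiable (at t) \<and> 1 / w t * deriv g t = \<phi> t"
      using sol unfolding bvp_solution_def left_derivative_def g_def \<phi>_def
      by (subst (asm) AE_lebesgue_on_iff) auto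
    hence deriv: "AE t in lborel. t \<in> {0..1} \<longrightarrow>
        (g has_real_derivative indicator {0..1} t * (\<phi> t * w t)) (at t)"
    proof eventually_elim
      case (elim t)
      show ?case
      proof
        assume t: "t \<in> {0..1}"
        with elim have "(g has_real_derivative deriv g t) (at t)"
          by (simp add: DERIV_deriv_iff_real_differentiable)
        moreover have "deriv g t = indicator {0..1} t * (\<phi> t * w t)"
          using elim t w_pos[OF t] by (auto simp: field_simps)
        ultimately show "(g has_real_derivative indicator {0..1} t * (\<phi> t * w t)) (at t)" by simp
      qed
    qed
    have g0: "g 0 = 0" using sol by (simp add: bvp_solution_def g_def)
    have g_eq: "g x = primitive w \<phi> x" if "x \<in> {0..1}" for x
      using abs_cont_has_integral_derivative[OF g_ac deriv, of 0 x] that g0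
      by (simp add: primitive_def integral_unique)
    \<comment> \<open>(A1) enters here: \<open>v\<close> is a continuous stand-in for the k-integral
      of \<open>\<phi>\<close>, which makes \<open>u - v\<close> a continuous function to which
      composition and injectivity of J apply.\<close>
    obtain v where v: "continuous_on {0..1} v"
      and v_AE: "AE x in lborel. x \<in> {0..1} \<longrightarrow> left_integral w k \<phi> x = v x"
      using A1[OF \<phi>] by (auto simp: is_cont_rep_iff)
    have uv: "continuous_on {0..1} (\<lambda>x. u x - v x)" using u v by (intro continuous_intros)
    \<comment> \<open>Both terms equal the primitive of \<open>\<phi>\<close>: for \<open>u\<close>
      through \<open>g\<close>, and for \<open>v\<close> because it represents the k-integral of
      \<open>\<phi>\<close>.\<close>
    have "AE x in lborel. x \<in> {0..1} \<longrightarrow> left_integral w k' (\<lambda>x. u x - v x) x = 0"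
      using left_integral_diff_AE[OF k' u v] compose[OF \<phi>] g_AE
    proof eventually_elim
      case (elim x)
      thus ?case using g_eq left_integral_cong_AE[OF v_AE] by auto
    qed
    hence "left_integral w k (left_integral w k' (\<lambda>x. u x - v x)) x = left_integral w k (\<lambda>_. 0) x"
      if "x \<in> {0..1}" for x using that by (rule left_integral_cong_AE)
    hence "left_integral w k (left_integral w k' (\<lambda>x. u x - v x)) x = 0" if "x \<in> {0..1}" for x
      using that by (simp add: left_integral_def)
    with compose'[OF uv] have "AE x in lborel. x \<in> {0..1} \<longrightarrow> primitive w (\<lambda>x. u x - v x) x = 0"
      by (auto elim: eventually_mono)
    from primitive_AE_0_imp_AE_0[OF weight uv this] v_AE show ?thesis
      by eventually_elim auto
  qed
  have sol: "bvp_solution w k' f u"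
    if fixed: "AE x in lborel. x \<in> {0..1} \<longrightarrow> left_integral w k \<phi> x = u x"
  proof -
    have prim_rep: "is_ac_rep (left_integral w k' u) (primitive w \<phi>)"
      unfolding is_ac_rep_iff
    proof
      show "AE x in lborel. x \<in> {0..1} \<longrightarrow> left_integral w k' u x = primitive w \<phi> x"
        using compose[OF \<phi>]
        by eventually_elim (use left_integral_cong_AE[OF fixed] in auto)
    qed (rule primitive_abs_cont[OF weight \<phi>])
    hence g: "is_ac_rep (left_integral w k' u) g" by (intro g_rep) auto
    \<comment> \<open>\<open>g\<close> is whatever representative the choice operator picks, so it
      is identified with the primitive through continuity, and only on [0,1].\<close>
    have "AE x in lborel. x \<in> {0..1} \<longrightarrow> g x = primitive w \<phi> x"
      using g prim_rep unfolding is_ac_rep_iff by (auto elim: eventually_elim2)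
    moreover have "continuous_on {0..1} g" "continuous_on {0..1} (primitive w \<phi>)"
      using g prim_rep by (auto simp: is_ac_rep_iff intro: abs_cont_imp_continuous)
    ultimately have g_eq: "g x = primitive w \<phi> x" if "x \<in> {0..1}" for x
      using that continuous_AE_eq by blast
    \<comment> \<open>At 0 and 1 a two-sided derivative of \<open>g\<close> would depend on its
      unknown values outside [0,1]; only interior points are kept.\<close>
    have "AE x in lborel. x \<noteq> (0::real)" "AE x in lborel. x \<noteq> (1::real)"
      by (rule AE_lborel_singleton)+
    with primitive_has_derivative_AE[OF weight \<phi>]
    have "AE t in lborel. t \<in> {0..1} \<longrightarrow> g differentiable (at t) \<and> 1 / w t * deriv g t = \<phi> t"
    proof eventually_elim
      case (elim t)
      show ?case
      proof
        assume t: "t \<in> {0..1}"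
        hence "t \<in> {0<..<1}" using elim by auto
        with elim(1) t have D: "(g has_real_derivative w t * \<phi> t) (at t)"
          by (rule has_field_derivative_transform_within_open[OF mp open_greaterThanLessThan])
            (use g_eq in simp)
        hence "deriv g t = w t * \<phi> t" by (rule DERIV_imp_deriv)
        moreover have "g differentiable (at t)" using D by (auto simp: real_differentiable_def)
        ultimately show "g differentiable (at t) \<and> 1 / w t * deriv g t = \<phi> t"
          using w_pos[OF t] by simp
      qed
    qed
    hence "AE t in lebesgue_on {0..1}. g differentiable (at t) \<and> 1 / w t * deriv g t = \<phi> t"
      by (subst AE_lebesgue_on_iff) auto
    moreover have "g 0 = 0" using g_eq[of 0] by simp
    ultimately show ?thesis
      using u g unfolding bvp_solution_def left_derivative_def g_def \<phi>_def by blast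
  qed
  show ?thesis using fixed sol unfolding \<phi>_def by blast
qed

theorem theorem6p1:
  fixes w :: "real \<Rightarrow> real"
    and k k' :: "real \<Rightarrow> real \<Rightarrow> real"
    and f :: "real \<Rightarrow> real \<Rightarrow> real"
    and c :: real
  assumes weight: "weight_function w"
    and kernels: "k \<in> kernel_class w" "k' \<in> kernel_class w"
    and conj: "conjugate_kernels w k k'"
    and f_cont: "continuous_on ({0..1} \<times> UNIV) (\<lambda>(t, x). f t x)"
    and A1: "\<And>y. continuous_on {0..1} y \<Longrightarrow> \<exists>g. is_cont_rep (left_integral w k y) g"
    and A2: "\<And>t x1 x2. t \<in> {0..1} \<Longrightarrow> \<bar>f t x1 - f t x2\<bar> \<le> c * \<bar>x1 - x2\<bar>"
    and c_pos: "c > 0"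
    and c_small: "c * sup_norm (cont_rep (left_integral w k (\<lambda>_. 1))) < 1"
  shows "(\<exists>u. bvp_solution w k' f u) \<and>
         (\<forall>u v. bvp_solution w k' f u \<longrightarrow> bvp_solution w k' f v \<longrightarrow> (\<forall>t\<in>{0..1}. u t = v t))"
proof -
  define rep where "rep = (\<lambda>y. cont_rep (left_integral w k y))"
  have rep: "continuous_on {0..1} (rep y)"
    "AE x in lborel. x \<in> {0..1} \<longrightarrow> left_integral w k y x = rep y x"
    if "continuous_on {0..1} y" for y
    using someI_ex[OF A1[OF that]] by (simp_all add: is_cont_rep_iff rep_def cont_rep_def)
  define S where "S = sup_norm (rep (\<lambda>_. 1))"
  have cS: "c * S < 1" using c_small by (simp add: S_def rep_def)
  have S: "\<bar>rep (\<lambda>_. 1) t\<bar> \<le> S" if "t \<in> {0..1}" for t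
  proof -
    obtain B where "\<And>x. x \<in> {0..1} \<Longrightarrow> \<bar>rep (\<lambda>_. 1) x\<bar> \<le> B"
      using continuous_bounded_unit[OF rep(1)] continuous_on_const by metis
    thus ?thesis unfolding S_def sup_norm_def using that by (intro cSUP_upper bdd_aboveI2[of _ _ B])
  qed
  have S_nonneg: "S \<ge> 0" using S[of 0] by auto
  define F where "F = (\<lambda>u :: real \<Rightarrow> real. \<lambda>t. f t (u t))"
  have F: "continuous_on {0..1} (F u)" if "continuous_on {0..1} u" for u
    unfolding F_def using that
    by (intro continuous_on_compose2[OF f_cont, of _ "\<lambda>t. (t, u t)", simplified] continuous_intros) auto
  \<comment> \<open>The Lipschitz condition gives the factor \<open>c\<close> and the k-integral of
    1 gives \<open>S\<close>. The estimate is first obtained almost everywhere and then, both sides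
    being continuous, at every point.\<close>
  have contraction: "\<bar>rep (F u) t - rep (F v) t\<bar> \<le> c * S * D"
    if u: "continuous_on {0..1} u" and v: "continuous_on {0..1} v"
      and D: "\<And>t. t \<in> {0..1} \<Longrightarrow> \<bar>u t - v t\<bar> \<le> D" and t: "t \<in> {0..1}" for u v D t
  proof -
    have D0: "D \<ge> 0" using D[OF t] by auto
    have bound: "\<bar>F u t - F v t\<bar> \<le> c * D" if "t \<in> {0..1}" for t
    proof -
      have "\<bar>F u t - F v t\<bar> \<le> c * \<bar>u t - v t\<bar>" unfolding F_def by (rule A2[OF that])
      also have "\<dots> \<le> c * D" using D[OF that] c_pos by simp
      finally show ?thesis .
    qed
    have diff: "continuous_on {0..1} (\<lambda>t. F u t - F v t)" using F u v by (intro continuous_intros) auto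
    have "AE x in lborel. x \<in> {0..1} \<longrightarrow>
        \<bar>left_integral w k (\<lambda>t. F u t - F v t) x\<bar> \<le> c * D * left_integral w k (\<lambda>_. 1) x"
      by (rule left_integral_bound_AE[OF weight kernels(1) diff]) (rule bound)
    hence "AE x in lborel. x \<in> {0..1} \<longrightarrow> \<bar>rep (F u) x - rep (F v) x\<bar> \<le> c * S * D"
      using
        left_integral_diff_AE[OF kernels(1) F[OF u] F[OF v]]
        rep(2)[OF F[OF u]] rep(2)[OF F[OF v]] rep(2)[OF continuous_on_const[of _ 1]]
    proof eventually_elim
      case (elim x)
      show ?case
      proof
        assume x: "x \<in> {0..1}"
        have "\<bar>rep (F u) x - rep (F v) x\<bar> \<le> c * D * rep (\<lambda>_. 1) x" using elim x by simp
        also have "\<dots> \<le> c * D * S" using S[OF x] c_pos D0 by (intro mult_left_mono) auto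
        finally show "\<bar>rep (F u) x - rep (F v) x\<bar> \<le> c * S * D" by (simp add: mult_ac)
      qed
    qed
    moreover have "continuous_on {0..1} (\<lambda>x. \<bar>rep (F u) x - rep (F v) x\<bar>)"
      by (intro continuous_on_rabs continuous_on_diff rep(1) F u v)
    ultimately show ?thesis using continuous_AE_le[OF _ continuous_on_const _ t] by blast
  qed
  \<comment> \<open>Banach's theorem is used on the complete type of bounded continuous functions on
    the whole line; a function on [0,1] enters it by constant extension on both sides.\<close>
  define clamp :: "real \<Rightarrow> real" where "clamp = (\<lambda>t. max 0 (min 1 t))"
  have clamp: "clamp t \<in> {0..1}" "t \<in> {0..1} \<Longrightarrow> clamp t = t" for t by (auto simp: clamp_def)
  define ext :: "(real \<Rightarrow> real) \<Rightarrow> (real \<Rightarrow>\<^sub>C real)" where "ext = (\<lambda>u. Bcontfun (u \<circ> clamp))"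
  have ext: "apply_bcontfun (ext u) t = u (clamp t)" if u: "continuous_on {0..1} u" for u t
  proof -
    obtain B where B: "\<And>x. x \<in> {0..1} \<Longrightarrow> \<bar>u x\<bar> \<le> B" using continuous_bounded_unit[OF u] by blast
    have "continuous_on UNIV (u \<circ> clamp)"
      using clamp(1) by (intro continuous_on_compose continuous_on_subset[OF u])
        (auto simp: clamp_def intro!: continuous_intros)
    hence "u \<circ> clamp \<in> bcontfun" using B clamp(1) by (intro bcontfun_normI[of _ B]) auto
    thus ?thesis by (simp add: ext_def Bcontfun_inverse)
  qed
  define \<Phi> where "\<Phi> = (\<lambda>v. ext (rep (F (apply_bcontfun v))))"
  have \<Phi>: "apply_bcontfun (\<Phi> v) t = rep (F (apply_bcontfun v)) (clamp t)" for v t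
    unfolding \<Phi>_def using rep(1) F by (intro ext) auto
  have "\<exists>!v. \<Phi> v = v"
  proof (rule banach_fix_type)
    show "0 \<le> c * S" using c_pos S_nonneg by simp
    show "\<forall>u v. dist (\<Phi> u) (\<Phi> v) \<le> c * S * dist u v"
    proof (intro allI dist_bound)
      fix u v t
      show "dist (apply_bcontfun (\<Phi> u) t) (apply_bcontfun (\<Phi> v) t) \<le> c * S * dist u v"
        unfolding \<Phi> dist_real_def
        by (intro contraction clamp(1)) (auto simp: dist_real_def[symmetric] dist_bounded)
    qed
  qed (rule cS)
  then obtain v where v: "\<Phi> v = v" and unique: "\<And>v'. \<Phi> v' = v' \<Longrightarrow> v' = v" by blast
  note iff = bvp_solution_iff_fixed_point[OF weight kernels conj f_cont A1]
  have "bvp_solution w k' f (apply_bcontfun v)"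
  proof (subst iff)
    have "apply_bcontfun v x = rep (F (apply_bcontfun v)) x" if "x \<in> {0..1}" for x
      using \<Phi>[of v x] v clamp(2)[OF that] by simp
    moreover have "AE x in lborel. x \<in> {0..1} \<longrightarrow>
        left_integral w k (F (apply_bcontfun v)) x = rep (F (apply_bcontfun v)) x"
      by (intro rep(2) F) auto
    ultimately show "AE x in lborel. x \<in> {0..1} \<longrightarrow>
        left_integral w k (\<lambda>t. f t (apply_bcontfun v t)) x = apply_bcontfun v x"
      unfolding F_def by (auto elim: eventually_mono)
  qed auto
  moreover have "u t = apply_bcontfun v t" if sol: "bvp_solution w k' f u" and t: "t \<in> {0..1}" for u t
  proof -
    have u: "continuous_on {0..1} u" using sol by (simp add: bvp_solution_def)
    have fixed: "AE x in lborel. x \<in> {0..1} \<longrightarrow> left_integral w k (F u) x = u x"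
      using sol iff[OF _ u] unfolding F_def by simp
    \<comment> \<open>\<open>F u\<close> and \<open>F (ext u)\<close> may differ outside [0,1], so
      their chosen representatives cannot be equated outright; the k-integrals agree on [0,1], and
      continuity does the rest.\<close>
    have ext_u: "left_integral w k (F (apply_bcontfun (ext u))) x = left_integral w k (F u) x"
      if "x \<in> {0..1}" for x
      using that by (intro left_integral_cong_AE AE_I2) (auto simp: F_def ext[OF u] clamp(2))
    have ext_cont: "continuous_on {0..1} (F (apply_bcontfun (ext u)))" by (intro F) auto
    have "AE x in lborel. x \<in> {0..1} \<longrightarrow> rep (F (apply_bcontfun (ext u))) x = u x"
      using rep(2)[OF ext_cont] fixed by eventually_elim (use ext_u in auto)
    hence "rep (F (apply_bcontfun (ext u))) x = u x" if "x \<in> {0..1}" for x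
      using continuous_AE_eq[OF rep(1)[OF ext_cont] u _ that] by blast
    hence "\<Phi> (ext u) = ext u"
      using clamp(1) by (intro bcontfun_eqI) (simp add: \<Phi> ext[OF u])
    hence "ext u = v" by (rule unique)
    thus ?thesis using ext[OF u, of t] clamp(2)[OF t] by simp
  qed
  ultimately show ?thesis by metis
qed

end
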